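(* Let $G=(V,E)$ be an undirected graph with $n$ vertices and $m$ edges, where $E\neq\varnothing$. Let $\mathbb{S}^{d-1}=\{x\in\mathbb{R}^d:\lVert x\rVert=1\}$ denote the unit $\ell^2$-sphere in $\mathbb{R}^d$. The clique number $\omega(G)$ and stability number $\alpha(G)$ may be determined via cubic optimization over spheres: $$1-\frac{1}{\omega(G)}=\frac{27}{2}\max_{(u,w)\in\mathbb{S}^{n+m-1}}\Bigl[\sum_{\{i,j\}\in E}u_iu_jw_{ij}\Bigr]^2,$$ $$1-\frac{1}{\alpha(G)}=\frac{27}{2}\max_{(u,w)\in\mathbb{S}^{n+m-1}}\Bigl[\sum_{\{i,j\}\notin E}u_iu_jw_{ij}\Bigr]^2.$$
   Context: The vertex set is $V=\{1,\dots,n\}$ and $m=|E|$ is the number of edges. A subset $S\subseteq V$ is a clique if $\{i,j\}\in E$ for all distinct $i,j\in S$, and is stable if $\{i,j\}\notin E$ for all distinct $i,j\in S$. The clique number $\omega(G)$ is the maximum cardinality of a clique, and the stability number $\alpha(G)$ is the maximum cardinality of a stable set. In both formulas a point of $\mathbb{S}^{n+m-1}\subset\mathbb{R}^{n+m}$ is written $(u,w)$, where $u=(u_1,\dots,u_n)$ is indexed by the vertices and the coordinates of $w$ are written $w_{ij}$, indexed by the unordered pairs $\{i,j\}$ over which the sum in that formula runs: the edges in the first formula, and the pairs of distinct vertices not in $E$ in the second.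
   Formalization: In the second formula the sphere is taken in dimension n plus the number of non-edges (coordinates of w indexed by pairs not in E), since with m = |E| the sphere S^{n+m-1} does not have the coordinates the sum needs. *)

theory Defs
  imports "HOL-Analysis.Analysis" "HOL-Library.Ramsey"
begin

definition clique_number :: "'a set \<Rightarrow> 'a set set \<Rightarrow> nat" where
  "clique_number V E = Max (card ` {S. S \<subseteq> V \<and> clique S E})"

definition stability_number :: "'a set \<Rightarrow> 'a set set \<Rightarrow> nat" where
  "stability_number V E = Max (card ` {S. S \<subseteq> V \<and> indep S E})"

text \<open>The unit sphere of Euclidean space with coordinates indexed by a finite set \<open>I\<close>, whose
  dimension depends on the graph and so cannot be a type. Points are functions that are
  \<open>undefined\<close> outside \<open>I\<close>, so that they correspond exactly to coordinate vectors.\<close>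

definition unit_sphere :: "'i set \<Rightarrow> ('i \<Rightarrow> real) set" where
  "unit_sphere I = {x \<in> I \<rightarrow>\<^sub>E UNIV. L2_set x I = 1}"

text \<open>A point \<open>(u, w)\<close> is a single vector \<open>x\<close> indexed by the disjoint sum \<open>V <+> P\<close> of the
  vertices and a set \<open>P\<close> of two-element subsets of \<open>V\<close>: \<open>u\<^sub>i = x (Inl i)\<close> and
  \<open>w\<^sub>i\<^sub>j = x (Inr {i, j})\<close>. For \<open>e = {i, j}\<close> the product over \<open>e\<close> is \<open>u\<^sub>i u\<^sub>j\<close>.\<close>

definition pair_cubic :: "'a set set \<Rightarrow> ('a + 'a set \<Rightarrow> real) \<Rightarrow> real" where
  "pair_cubic P x = (\<Sum>e\<in>P. (\<Prod>i\<in>e. x (Inl i)) * x (Inr e))"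

lemma card_coordinates:
  assumes "finite V" "P \<subseteq> [V]\<^bsup>2\<^esup>"
  shows "card (V <+> P) = card V + card P"
  using assms by (meson card_Plus finite_imp_finite_nsets finite_subset)

lemma pair_cubic_doubleton:
  assumes "i \<noteq> j"
  shows "pair_cubic {{i, j}} x = x (Inl i) * x (Inl j) * x (Inr {i, j})"
  using assms by (simp add: pair_cubic_def)

definition is_maximum_on :: "('a \<Rightarrow> real) \<Rightarrow> 'a set \<Rightarrow> real \<Rightarrow> bool" where
  "is_maximum_on f A M \<longleftrightarrow> (\<exists>x\<in>A. f x = M) \<and> (\<forall>x\<in>A. f x \<le> M)"

end

theory Submission
  imports Defs
begin

text \<open>For fixed \<open>u\<close>, Cauchy-Schwarz makes \<open>w\<close> proportional to \<open>(u\<^sub>i u\<^sub>j)\<^sub>i\<^sub>j\<close>, so the squared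
  cubic form is at most \<open>(1 - a) \<Sum> u\<^sub>i\<^sup>2 u\<^sub>j\<^sup>2\<close>, where \<open>a\<close> is the squared norm of \<open>u\<close>. By
  the Motzkin-Straus theorem applied to the squares \<open>u\<^sub>i\<^sup>2\<close>, this is at most
  \<open>(1 - a) a\<^sup>2 (1 - 1/\<omega>) / 2\<close>, and \<open>(1 - a) a\<^sup>2\<close> has maximum \<open>4/27\<close>, at \<open>a = 2/3\<close>.
  Equality occurs when \<open>u\<close> and \<open>w\<close> are constant on a maximum clique and its edges.
  The stability number is the clique number of the complementary graph.\<close>

section \<open>The Motzkin-Straus inequality for cliques\<close>

definition edge_form :: "'a set set \<Rightarrow> 'a set \<Rightarrow> ('a \<Rightarrow> real) \<Rightarrow> real" where
  "edge_form P S y = (\<Sum>e | e \<in> P \<and> e \<subseteq> S. \<Prod>i\<in>e. y i)"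

text \<open>For \<open>i\<close> outside \<open>S\<close>, this is the partial derivative in
  \<open>y i\<close> of the edge form on \<open>insert i S\<close>.\<close>

definition neighbour_sum :: "'a set set \<Rightarrow> 'a set \<Rightarrow> ('a \<Rightarrow> real) \<Rightarrow> 'a \<Rightarrow> real" where
  "neighbour_sum P S y i = (\<Sum>k | k \<in> S \<and> {i, k} \<in> P. y k)"

lemma edge_form_cong:
  "(\<And>i. i \<in> S \<Longrightarrow> y i = z i) \<Longrightarrow> edge_form P S y = edge_form P S z"
  unfolding edge_form_def by (intro sum.cong prod.cong) auto

lemma neighbour_sum_cong:
  "(\<And>i. i \<in> S \<Longrightarrow> y i = z i) \<Longrightarrow> neighbour_sum P S y k = neighbour_sum P S z k"
  unfolding neighbour_sum_def by (intro sum.cong) auto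

text \<open>An edge inside \<open>insert i S\<close> either avoids \<open>i\<close> or is
  \<open>{i, k}\<close> for a unique neighbour \<open>k\<close> in \<open>S\<close>. The edge set
  stays fixed while the vertex set varies, so inductions can add or remove vertices.\<close>

lemma edge_form_insert:
  assumes "finite S" "i \<notin> S" "\<And>e. e \<in> P \<Longrightarrow> card e = 2"
  shows "edge_form P (insert i S) y = edge_form P S y + y i * neighbour_sum P S y i"
proof -
  let ?A = "{e. e \<in> P \<and> e \<subseteq> S}" and ?K = "{k. k \<in> S \<and> {i, k} \<in> P}"
  let ?B = "(\<lambda>k. {i, k}) ` ?K"
  have "{e. e \<in> P \<and> e \<subseteq> insert i S} = ?A \<union> ?B"
  proof (intro equalityI subsetI)
    fix e assume e: "e \<in> {e. e \<in> P \<and> e \<subseteq> insert i S}"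
    show "e \<in> ?A \<union> ?B"
    proof (cases "i \<in> e")
      case True
      moreover have "card e = 2" using e assms(3) by blast
      ultimately obtain k where "e = {i, k}" "k \<noteq> i"
        by (auto simp: card_2_iff)
      then show ?thesis using e by auto
    qed (use e in auto)
  qed auto
  moreover have "finite ?A"
    by (rule finite_subset[of _ "Pow S"]) (use assms(1) in auto)
  moreover have "finite ?B" using assms(1) by simp
  moreover have "?A \<inter> ?B = {}" using assms(2) by auto
  ultimately have "edge_form P (insert i S) y = edge_form P S y + (\<Sum>e\<in>?B. \<Prod>i\<in>e. y i)"
    unfolding edge_form_def by (simp add: sum.union_disjoint)
  also have "(\<Sum>e\<in>?B. \<Prod>i\<in>e. y i) = (\<Sum>k\<in>?K. \<Prod>i\<in>{i, k}. y i)"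
    by (rule sum.reindex_cong[OF _ refl refl]) (auto simp: inj_on_def doubleton_eq_iff)
  also have "\<dots> = (\<Sum>k\<in>?K. y i * y k)"
    using assms(2) by (intro sum.cong prod.insert[THEN trans]) auto
  finally show ?thesis
    by (simp add: neighbour_sum_def sum_distrib_left)
qed

text \<open>In a clique every pair is an edge, so the edge form collects exactly the cross terms of
  the squared sum.\<close>

lemma edge_form_clique:
  assumes "finite S" "clique S P" "\<And>e. e \<in> P \<Longrightarrow> card e = 2"
  shows "2 * edge_form P S y = (\<Sum>i\<in>S. y i)\<^sup>2 - (\<Sum>i\<in>S. (y i)\<^sup>2)"
  using assms(1,2)
proof (induction S rule: finite_induct)
  case empty
  have "{e. e \<in> P \<and> e \<subseteq> {}} = {}" using assms(3) by fastforce
  then show ?case unfolding edge_form_def by (metis sum.empty mult_zero_right diff_self power_zero_numeral)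
next
  case (insert i S)
  have "clique S P" using insert.prems by (auto simp: clique_def)
  moreover have "{k. k \<in> S \<and> {i, k} \<in> P} = S"
    using insert.prems insert.hyps by (auto simp: clique_def)
  ultimately show ?case
    using insert edge_form_insert[of S i P y] assms(3)
    by (simp add: neighbour_sum_def power2_sum algebra_simps)
qed

text \<open>Moving all the weight of \<open>j\<close> to a nonadjacent vertex \<open>i\<close> with at least the same
  neighbour sum does not decrease the edge form, so induction reduces the bound to cliques.\<close>

theorem motzkin_straus:
  assumes "finite S" "\<And>e. e \<in> P \<Longrightarrow> card e = 2" "\<And>i. i \<in> S \<Longrightarrow> 0 \<le> y i"
    and "\<And>T. T \<subseteq> S \<Longrightarrow> clique T P \<Longrightarrow> card T \<le> k" "0 < k"
  shows "2 * edge_form P S y \<le> (1 - 1 / real k) * (\<Sum>i\<in>S. y i)\<^sup>2"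
  using assms(1,3,4)
proof (induction "card S" arbitrary: S y rule: less_induct)
  case less
  show ?case
  proof (cases "clique S P")
    case True
    have "card S \<le> k" using less.prems(3) True by blast
    \<comment> \<open>Cauchy-Schwarz against the constant vector 1 bounds the sum of squares from
      below, with \<open>card S\<close> at most \<open>k\<close>.\<close>
    have "(\<Sum>i\<in>S. y i)\<^sup>2 \<le> (\<Sum>i\<in>S. (y i)\<^sup>2) * real (card S)"
      using Cauchy_Schwarz_ineq_sum[of y "\<lambda>_. 1" S] by simp
    also have "\<dots> \<le> (\<Sum>i\<in>S. (y i)\<^sup>2) * real k"
      using \<open>card S \<le> k\<close> by (intro mult_left_mono) (auto intro: sum_nonneg)
    finally have "(\<Sum>i\<in>S. y i)\<^sup>2 / real k \<le> (\<Sum>i\<in>S. (y i)\<^sup>2)"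
      using assms(5) by (simp add: field_simps)
    then show ?thesis
      using edge_form_clique[OF less.prems(1) True, of y] assms(2) by (simp add: algebra_simps)
  next
    case False
    then obtain a b where "a \<in> S" "b \<in> S" "a \<noteq> b" "{a, b} \<notin> P"
      by (auto simp: clique_def)
    \<comment> \<open>The nonadjacent pair is ordered so that \<open>i\<close> has the larger
      neighbour sum.\<close>
    then obtain i j where ij: "i \<in> S" "j \<in> S" "i \<noteq> j" "{i, j} \<notin> P"
      and le: "neighbour_sum P (S - {i, j}) y j \<le> neighbour_sum P (S - {i, j}) y i"
    proof (cases "neighbour_sum P (S - {a, b}) y b \<le> neighbour_sum P (S - {a, b}) y a")
      case True
      then show ?thesis using that[of a b] \<open>a \<in> S\<close> \<open>b \<in> S\<close> \<open>a \<noteq> b\<close> \<open>{a, b} \<notin> P\<close> by blast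
    next
      case False
      then show ?thesis using that[of b a] \<open>a \<in> S\<close> \<open>b \<in> S\<close> \<open>a \<noteq> b\<close> \<open>{a, b} \<notin> P\<close>
        by (simp add: insert_commute)
    qed
    define R where "R = S - {i, j}"
    \<comment> \<open>The weight of \<open>j\<close> passes to \<open>i\<close>, and
      \<open>j\<close> is then dropped from the vertex set; the total weight is unchanged.\<close>
    define z where "z = y(i := y i + y j)"
    have R: "finite R" "i \<notin> R" "j \<notin> R" "S = insert j (insert i R)"
      using less.prems(1) ij by (auto simp: R_def)
    \<comment> \<open>Since \<open>i\<close> and \<open>j\<close> are nonadjacent, no term
      \<open>y i * y j\<close> occurs, and the form is linear in the two weights jointly.\<close>
    have "neighbour_sum P (insert i R) y j = neighbour_sum P R y j"
    proof -
      have "{k. k \<in> insert i R \<and> {j, k} \<in> P} = {k. k \<in> R \<and> {j, k} \<in> P}"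
        using ij(4) by (auto simp: insert_commute)
      then show ?thesis by (simp add: neighbour_sum_def)
    qed
    then have "edge_form P S y
        = edge_form P R y + y i * neighbour_sum P R y i + y j * neighbour_sum P R y j"
      using R ij(3) assms(2) by (simp add: edge_form_insert)
    also have "\<dots> \<le> edge_form P R y + (y i + y j) * neighbour_sum P R y i"
      using mult_left_mono[OF le, of "y j"] less.prems(2) ij(2)
      by (simp add: R_def algebra_simps)
    also have "\<dots> = edge_form P R z + z i * neighbour_sum P R z i"
    proof -
      have "y l = z l" if "l \<in> R" for l using that R(2) by (auto simp: z_def)
      then show ?thesis
        using edge_form_cong[of R y z P] neighbour_sum_cong[of R y z P i]
        by (simp add: z_def)
    qed
    also have "\<dots> = edge_form P (insert i R) z"
      using edge_form_insert[OF R(1,2), of P z] assms(2) by simp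
    finally have "2 * edge_form P S y \<le> 2 * edge_form P (insert i R) z" by simp
    also have "\<dots> \<le> (1 - 1 / real k) * (\<Sum>i\<in>insert i R. z i)\<^sup>2"
    proof (rule less.hyps)
      show "card (insert i R) < card S"
        using R ij(3) by simp
      show "0 \<le> z l" if "l \<in> insert i R" for l
        using that less.prems(2) R(4) by (auto simp: z_def)
      show "card T \<le> k" if "T \<subseteq> insert i R" "clique T P" for T
        using that less.prems(3) R(4) by blast
    qed (use R(1) in simp)
    also have "(\<Sum>i\<in>insert i R. z i) = (\<Sum>i\<in>S. y i)"
    proof -
      have "(\<Sum>l\<in>R. z l) = (\<Sum>l\<in>R. y l)"
        by (rule sum.cong) (use R(2) in \<open>auto simp: z_def\<close>)
      then show ?thesis using R(1-4) ij(3) by (simp add: z_def)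
    qed
    finally show ?thesis .
  qed
qed

section \<open>Clique and stability numbers\<close>

lemma clique_number_attained:
  assumes "finite V"
  obtains S where "S \<subseteq> V" "clique S P" "card S = clique_number V P"
proof -
  have "clique_number V P \<in> card ` {S. S \<subseteq> V \<and> clique S P}"
    unfolding clique_number_def using assms
    by (intro Max_in) (auto intro: exI[of _ "{}"] simp: clique_def)
  then show ?thesis using that by auto
qed

lemma clique_card_le:
  assumes "finite V" "S \<subseteq> V" "clique S P"
  shows "card S \<le> clique_number V P"
  unfolding clique_number_def using assms by (intro Max_ge) auto

lemma clique_number_pos:
  assumes "finite V" "V \<noteq> {}"
  shows "0 < clique_number V P"
proof -
  obtain v where "v \<in> V" using assms(2) by blast
  then show ?thesis
    using clique_card_le[OF assms(1), of "{v}" P] by (simp add: clique_def)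
qed

text \<open>Within \<open>V\<close>, distinct vertices are nonadjacent exactly when their pair lies
  in the complement. Hence one result for arbitrary \<open>P\<close> covers both formulas.\<close>

lemma stability_number_eq_clique_number:
  "stability_number V E = clique_number V ([V]\<^bsup>2\<^esup> - E)"
proof -
  have "indep S E \<longleftrightarrow> clique S ([V]\<^bsup>2\<^esup> - E)" if "S \<subseteq> V" for S
    using that by (auto simp: indep_def clique_def nsets_def card_2_iff)
  then show ?thesis
    unfolding stability_number_def clique_number_def by (metis (no_types, lifting) Collect_cong)
qed

section \<open>The cubic form on the sphere: upper bound and attainment\<close>

lemma unit_sphere_Plus_iff:
  assumes "finite V" "finite P"
  shows "x \<in> unit_sphere (V <+> P) \<longleftrightarrow> x \<in> extensional (V <+> P) \<and>
    (\<Sum>i\<in>V. (x (Inl i))\<^sup>2) + (\<Sum>e\<in>P. (x (Inr e))\<^sup>2) = 1"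
  using assms by (auto simp: unit_sphere_def L2_set_def sum.Plus PiE_def)

lemma mult_square_le_4_27:
  fixes a :: real
  assumes "0 \<le> a"
  shows "(1 - a) * a\<^sup>2 \<le> 4 / 27"
proof -
  \<comment> \<open>The difference of the two sides has a double root at the maximiser 2/3, which
    gives this factorisation.\<close>
  have "0 \<le> (a - 2 / 3)\<^sup>2 * (a + 1 / 3)" using assms by simp
  also have "\<dots> = 4 / 27 - (1 - a) * a\<^sup>2" by (simp add: field_simps power2_eq_square)
  finally show ?thesis by simp
qed

lemma pair_cubic_sq_le:
  assumes "finite V" "V \<noteq> {}" "P \<subseteq> [V]\<^bsup>2\<^esup>" "x \<in> unit_sphere (V <+> P)"
  shows "(pair_cubic P x)\<^sup>2 \<le> 2 / 27 * (1 - 1 / real (clique_number V P))"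
proof -
  let ?k = "clique_number V P"
  let ?u = "\<lambda>i. (x (Inl i))\<^sup>2"
  define a where "a = (\<Sum>i\<in>V. ?u i)"
  have "finite P" using assms(1,3) finite_imp_finite_nsets finite_subset by blast
  then have w: "(\<Sum>e\<in>P. (x (Inr e))\<^sup>2) = 1 - a"
    using assms(1,4) by (simp add: unit_sphere_Plus_iff a_def)
  have card: "card e = 2" if "e \<in> P" for e using that assms(3) by (auto simp: nsets_def)
  have k: "1 / real ?k \<le> 1" using clique_number_pos[OF assms(1,2), of P] by simp
  have "{e. e \<in> P \<and> e \<subseteq> V} = P" using assms(3) by (auto simp: nsets_def)
  then have form: "edge_form P V ?u = (\<Sum>e\<in>P. (\<Prod>i\<in>e. x (Inl i))\<^sup>2)"
    by (simp add: edge_form_def prod_power_distrib)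
  have "2 * edge_form P V ?u \<le> (1 - 1 / real ?k) * a\<^sup>2"
    unfolding a_def
    using assms(1) card clique_card_le[OF assms(1)] clique_number_pos[OF assms(1,2)]
    by (intro motzkin_straus) auto
  \<comment> \<open>\<open>1 - a\<close> is the squared norm of \<open>w\<close>, the second factor
    in the Cauchy-Schwarz bound used at the end.\<close>
  moreover have "0 \<le> 1 - a" unfolding w[symmetric] by (rule sum_nonneg) simp
  ultimately have "2 * edge_form P V ?u * (1 - a) \<le> (1 - 1 / real ?k) * a\<^sup>2 * (1 - a)"
    by (rule mult_right_mono)
  also have "\<dots> = (1 - 1 / real ?k) * ((1 - a) * a\<^sup>2)" by simp
  also have "\<dots> \<le> (1 - 1 / real ?k) * (4 / 27)"
    using k by (intro mult_left_mono mult_square_le_4_27) (auto simp: a_def intro: sum_nonneg)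
  finally show ?thesis
    using Cauchy_Schwarz_ineq_sum[of "\<lambda>e. \<Prod>i\<in>e. x (Inl i)" "\<lambda>e. x (Inr e)" P]
    unfolding w form pair_cubic_def by simp
qed

text \<open>The witness spreads \<open>u\<close> evenly over the clique and \<open>w\<close> evenly
  over its edges. Two vertices ensure that there is an edge to carry \<open>w\<close>.\<close>

lemma pair_cubic_sq_attained_on_clique:
  assumes "finite V" "P \<subseteq> [V]\<^bsup>2\<^esup>" "S \<subseteq> V" "clique S P" "2 \<le> card S"
  shows "\<exists>x\<in>unit_sphere (V <+> P). (pair_cubic P x)\<^sup>2 = 2 / 27 * (1 - 1 / real (card S))"
proof -
  define k where "k = real (card S)"
  \<comment> \<open>The optimal split gives \<open>u\<close> squared norm 2/3, shared by
    \<open>k\<close> vertices, and \<open>w\<close> squared norm 1/3, shared by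
    \<open>k * (k - 1) / 2\<close> edges.\<close>
  define c d where "c = sqrt (2 / (3 * k))" and "d = sqrt (2 / (3 * k * (k - 1)))"
  define x where "x = restrict (case_sum (\<lambda>i. if i \<in> S then c else 0)
    (\<lambda>e. if e \<subseteq> S then d else 0)) (V <+> P)"
  have k: "2 \<le> k" using assms(5) by (simp add: k_def)
  have P: "finite P" using assms(1,2) finite_imp_finite_nsets finite_subset by blast
  have fS: "finite S" using assms(1,3) finite_subset by blast
  have edges: "{e\<in>P. e \<subseteq> S} = [S]\<^bsup>2\<^esup>"
  proof -
    have "[S]\<^bsup>2\<^esup> \<subseteq> P" using assms(4) by (auto simp: clique_def nsets_def card_2_iff)
    then show ?thesis using assms(2) fS by (auto simp: nsets_def)
  qed
  have card: "real (card S choose 2) = k * (k - 1) / 2"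
  proof -
    have "2 * (card S choose 2) = card S * (card S - 1)"
      unfolding choose_two by (rule dvd_mult_div_cancel) (cases "card S"; simp)
    then have "2 * real (card S choose 2) = real (card S) * real (card S - 1)"
      by (metis of_nat_mult of_nat_numeral)
    then show ?thesis using assms(5) by (simp add: k_def of_nat_diff)
  qed
  have cc: "c\<^sup>2 = 2 / (3 * k)" and dd: "d\<^sup>2 = 2 / (3 * k * (k - 1))"
    using k by (simp_all add: c_def d_def)
  have u: "(\<Sum>i\<in>V. (x (Inl i))\<^sup>2) = 2 / 3"
  proof -
    have "(\<Sum>i\<in>V. (x (Inl i))\<^sup>2) = (\<Sum>i\<in>V. if i \<in> S then c\<^sup>2 else 0)"
      by (rule sum.cong) (auto simp: x_def)
    also have "\<dots> = k * c\<^sup>2"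
      using assms(1,3) by (simp add: sum.inter_restrict[symmetric] Int_absorb1 k_def)
    finally show ?thesis using k by (simp add: cc)
  qed
  have w: "(\<Sum>e\<in>P. (x (Inr e))\<^sup>2) = 1 / 3"
  proof -
    have "(\<Sum>e\<in>P. (x (Inr e))\<^sup>2) = (\<Sum>e\<in>P. if e \<subseteq> S then d\<^sup>2 else 0)"
      by (rule sum.cong) (auto simp: x_def)
    also have "\<dots> = k * (k - 1) / 2 * d\<^sup>2"
      using P by (simp add: sum.inter_filter[symmetric] edges card)
    finally show ?thesis using k by (simp add: dd)
  qed
  have "pair_cubic P x = (\<Sum>e\<in>P. if e \<subseteq> S then c\<^sup>2 * d else 0)"
    unfolding pair_cubic_def
  proof (intro sum.cong refl)
    fix e assume e: "e \<in> P"
    then have "e \<subseteq> V" "card e = 2" using assms(2) by (auto simp: nsets_def)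
    moreover have "(\<Prod>i\<in>e. x (Inl i)) = (\<Prod>i\<in>e. c)" if "e \<subseteq> S"
      using that \<open>e \<subseteq> V\<close> by (intro prod.cong) (auto simp: x_def)
    ultimately show "(\<Prod>i\<in>e. x (Inl i)) * x (Inr e) = (if e \<subseteq> S then c\<^sup>2 * d else 0)"
      using e by (auto simp: x_def)
  qed
  also have "\<dots> = k * (k - 1) / 2 * (c\<^sup>2 * d)"
    using P by (simp add: sum.inter_filter[symmetric] edges card)
  finally have pc: "pair_cubic P x = k * (k - 1) / 2 * (c\<^sup>2 * d)" .
  have "(pair_cubic P x)\<^sup>2 = (k * (k - 1) / 2 * c\<^sup>2)\<^sup>2 * d\<^sup>2"
    unfolding pc by (simp only: power_mult_distrib mult.assoc)
  also have "\<dots> = 2 / 27 * (1 - 1 / k)"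
    using k unfolding cc dd by (simp add: divide_simps power2_eq_square)
  finally have "(pair_cubic P x)\<^sup>2 = 2 / 27 * (1 - 1 / k)" .
  moreover have "x \<in> unit_sphere (V <+> P)"
    using u w assms(1) P by (simp add: unit_sphere_Plus_iff) (simp add: x_def)
  ultimately show ?thesis by (auto simp: k_def)
qed

text \<open>A standard basis vector is a point of the sphere; this serves the case of clique number
  1, where no edge is available for the clique witness.\<close>

lemma unit_sphere_nonempty:
  assumes "finite I" "i \<in> I"
  obtains x where "x \<in> unit_sphere I"
proof
  have "(\<Sum>j\<in>I. ((\<lambda>j\<in>I. if j = i then 1 else 0 :: real) j)\<^sup>2) = (\<Sum>j\<in>I. if j = i then 1 else 0)"
    by (rule sum.cong) auto
  then show "(\<lambda>j\<in>I. if j = i then 1 else 0) \<in> unit_sphere I"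
    using assms by (simp add: unit_sphere_def L2_set_def)
qed

theorem pair_cubic_sq_maximum:
  assumes "finite V" "V \<noteq> {}" "P \<subseteq> [V]\<^bsup>2\<^esup>"
  shows "is_maximum_on (\<lambda>x. (pair_cubic P x)\<^sup>2) (unit_sphere (V <+> P))
    (2 / 27 * (1 - 1 / real (clique_number V P)))"
proof -
  let ?M = "2 / 27 * (1 - 1 / real (clique_number V P))"
  note le = pair_cubic_sq_le[OF assms]
  have "\<exists>x\<in>unit_sphere (V <+> P). (pair_cubic P x)\<^sup>2 = ?M"
  proof (cases "2 \<le> clique_number V P")
    case True
    then show ?thesis
      using clique_number_attained[OF assms(1), of P]
        pair_cubic_sq_attained_on_clique[OF assms(1,3)] by metis
  next
    \<comment> \<open>With clique number 1 the upper bound is 0, and a square is nonnegative, so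
      every point of the sphere attains it. In the stability formula this is the case of a complete
      graph.\<close>
    case False
    then have 1: "clique_number V P = 1"
      using clique_number_pos[OF assms(1,2), of P] by linarith
    have "finite (V <+> P)"
      using assms(1) finite_subset[OF assms(3)] by (simp add: finite_imp_finite_nsets)
    moreover obtain v where "v \<in> V" using assms(2) by blast
    ultimately obtain x where "x \<in> unit_sphere (V <+> P)"
      using unit_sphere_nonempty[of "V <+> P" "Inl v"] by auto
    then show ?thesis using le 1 by force
  qed
  then show ?thesis using le by (auto simp: is_maximum_on_def)
qed

theorem theorem3p2:
  fixes n :: nat and V :: "nat set" and E :: "nat set set"
  assumes V: "V = {1..n}"
    and E: "E \<subseteq> [V]\<^bsup>2\<^esup>" "E \<noteq> {}"
  shows "(\<exists>M. is_maximum_on (\<lambda>x. (pair_cubic E x)\<^sup>2) (unit_sphere (V <+> E)) M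
              \<and> 1 - 1 / real (clique_number V E) = 27 / 2 * M)
       \<and> (\<exists>M. is_maximum_on (\<lambda>x. (pair_cubic ([V]\<^bsup>2\<^esup> - E) x)\<^sup>2) (unit_sphere (V <+> ([V]\<^bsup>2\<^esup> - E))) M
              \<and> 1 - 1 / real (stability_number V E) = 27 / 2 * M)"
proof -
  \<comment> \<open>An edge supplies a vertex, so \<open>V\<close> is nonempty.\<close>
  have "finite V" "V \<noteq> {}" using V E by (auto simp: nsets_def)
  then have "\<exists>M. is_maximum_on (\<lambda>x. (pair_cubic P x)\<^sup>2) (unit_sphere (V <+> P)) M
      \<and> 1 - 1 / real (clique_number V P) = 27 / 2 * M" if "P \<subseteq> [V]\<^bsup>2\<^esup>" for P
    using pair_cubic_sq_maximum[OF _ _ that] by (intro exI conjI) auto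
  then show ?thesis
    using E(1) by (simp add: stability_number_eq_clique_number)
qed

end
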